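(* Let $\Gamma$ be a finite group with right regular representation $R$. A linear map $G:\mathbb Z_2^\Gamma\to\mathbb Z_2^\Gamma$ is the Gramian of a binary Parseval $\Gamma$-frame (for $\mathbb Z_2^n$, for some $n$) if and only if $G$ is symmetric and idempotent, $G\in\mathbb Z_2[\{R_g\}]$, and the range of $G$ contains an odd vector.
   Context: All vectors and matrices are over the field $\mathbb Z_2$ with two elements. A vector is odd if it has an odd number of entries equal to $1$. A linear map on $\mathbb Z_2^\Gamma$ (the space of functions $\Gamma\to\mathbb Z_2$) is identified with its matrix in the standard basis; it is symmetric if it equals its transpose. The dot product on $\mathbb Z_2^n$ is $\langle a,b\rangle=\sum_{i=1}^n a_ib_i\in\mathbb Z_2$. A finite family $\{f_j\}_{j\in J}$ in $\mathbb Z_2^n$ is a binary Parseval frame if $x=\sum_{j\in J}\langle x,f_j\rangle f_j$ for all $x\in\mathbb Z_2^n$. For a finite group $\Gamma$ with identity $e$, a family $\{f_g\}_{g\in\Gamma}$ in $\mathbb Z_2^n$ is a binary Parseval $\Gamma$-frame if it is a binary Parseval frame and there is a representation (group homomorphism) $\rho:\Gamma\to \mathrm{GL}(\mathbb Z_2^n)$ with $f_g=\rho(g)f_e$ for all $g\in\Gamma$. The Gramian of $\{f_g\}_{g\in\Gamma}$ is the linear map on $\mathbb Z_2^\Gamma$ with matrix entries $G_{a,b}=\langle f_b,f_a\rangle$. The right regular representation acts on functions $\varphi:\Gamma\to\mathbb Z_2$ by $(R_g\varphi)(h)=\varphi(hg)$. $\mathbb Z_2[\{R_g\}]$ is the set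 of all $\mathbb Z_2$-linear combinations of the $R_g$, $g\in\Gamma$. *)

theory Defs
  imports
    "HOL-Algebra.Group"
    "HOL-Library.FuncSet"
    "HOL-Library.Z2"
    "Jordan_Normal_Form.Matrix"
begin

text \<open>The field with two elements is the type \<^typ>\<open>bit\<close>; the space of functions from a set \<open>S\<close>
  to it is \<open>S \<rightarrow>\<^sub>E UNIV\<close>. Functions on \<open>S\<close> and operators on this space are extensional (equal to
  \<^const>\<open>undefined\<close> outside their domain), so that HOL equality is equality of functions on \<open>S\<close>
  and of linear maps respectively.\<close>

abbreviation bit_functions :: "'g set \<Rightarrow> ('g \<Rightarrow> bit) set" where
  "bit_functions S \<equiv> S \<rightarrow>\<^sub>E UNIV"

definition linear_operators :: "'g set \<Rightarrow> (('g \<Rightarrow> bit) \<Rightarrow> ('g \<Rightarrow> bit)) set" where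
  "linear_operators S =
    {T \<in> bit_functions S \<rightarrow>\<^sub>E bit_functions S.
       (\<forall>\<phi>\<in>bit_functions S. \<forall>\<psi>\<in>bit_functions S.
          T (\<lambda>h\<in>S. \<phi> h + \<psi> h) = (\<lambda>h\<in>S. T \<phi> h + T \<psi> h)) \<and>
       (\<forall>c. \<forall>\<phi>\<in>bit_functions S. T (\<lambda>h\<in>S. c * \<phi> h) = (\<lambda>h\<in>S. c * T \<phi> h))}"

definition std_basis :: "'g set \<Rightarrow> 'g \<Rightarrow> 'g \<Rightarrow> bit" where
  "std_basis S b = (\<lambda>h\<in>S. if h = b then 1 else 0)"

definition matrix_entry :: "'g set \<Rightarrow> (('g \<Rightarrow> bit) \<Rightarrow> ('g \<Rightarrow> bit)) \<Rightarrow> 'g \<Rightarrow> 'g \<Rightarrow> bit" where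
  "matrix_entry S T a b = T (std_basis S b) a"

definition symmetric_operator :: "'g set \<Rightarrow> (('g \<Rightarrow> bit) \<Rightarrow> ('g \<Rightarrow> bit)) \<Rightarrow> bool" where
  "symmetric_operator S T \<longleftrightarrow> (\<forall>a\<in>S. \<forall>b\<in>S. matrix_entry S T a b = matrix_entry S T b a)"

definition idempotent_operator :: "'g set \<Rightarrow> (('g \<Rightarrow> bit) \<Rightarrow> ('g \<Rightarrow> bit)) \<Rightarrow> bool" where
  "idempotent_operator S T \<longleftrightarrow> compose (bit_functions S) T T = T"

definition odd_vector :: "'g set \<Rightarrow> ('g \<Rightarrow> bit) \<Rightarrow> bool" where
  "odd_vector S \<phi> \<longleftrightarrow> odd (card {h \<in> S. \<phi> h = 1})"

definition right_regular ::
    "('g, 'm) monoid_scheme \<Rightarrow> 'g \<Rightarrow> ('g \<Rightarrow> bit) \<Rightarrow> ('g \<Rightarrow> bit)" where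
  "right_regular \<Gamma> g =
    (\<lambda>\<phi>\<in>bit_functions (carrier \<Gamma>). \<lambda>h\<in>carrier \<Gamma>. \<phi> (h \<otimes>\<^bsub>\<Gamma>\<^esub> g))"

definition right_regular_algebra ::
    "('g, 'm) monoid_scheme \<Rightarrow> (('g \<Rightarrow> bit) \<Rightarrow> ('g \<Rightarrow> bit)) set" where
  "right_regular_algebra \<Gamma> =
    {(\<lambda>\<phi>\<in>bit_functions (carrier \<Gamma>). \<lambda>h\<in>carrier \<Gamma>.
        \<Sum>g\<in>carrier \<Gamma>. c g * right_regular \<Gamma> g \<phi> h) | c :: 'g \<Rightarrow> bit. True}"

definition parseval_frame :: "nat \<Rightarrow> 'j set \<Rightarrow> ('j \<Rightarrow> bit vec) \<Rightarrow> bool" where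
  "parseval_frame n J f \<longleftrightarrow>
    finite J \<and> (\<forall>j\<in>J. f j \<in> carrier_vec n) \<and>
    (\<forall>x\<in>carrier_vec n. x = finsum_vec TYPE(bit) n (\<lambda>j. (x \<bullet> f j) \<cdot>\<^sub>v f j) J)"

definition GL_bit :: "nat \<Rightarrow> bit mat monoid" where
  "GL_bit n = units_of (ring_mat TYPE(bit) n ())"

definition parseval_group_frame ::
    "nat \<Rightarrow> ('g, 'm) monoid_scheme \<Rightarrow> ('g \<Rightarrow> bit vec) \<Rightarrow> bool" where
  "parseval_group_frame n \<Gamma> f \<longleftrightarrow>
    parseval_frame n (carrier \<Gamma>) f \<and>
    (\<exists>\<rho> \<in> hom \<Gamma> (GL_bit n). \<forall>g\<in>carrier \<Gamma>. f g = \<rho> g *\<^sub>v f \<one>\<^bsub>\<Gamma>\<^esub>)"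

definition is_gramian ::
    "'g set \<Rightarrow> ('g \<Rightarrow> bit vec) \<Rightarrow> (('g \<Rightarrow> bit) \<Rightarrow> ('g \<Rightarrow> bit)) \<Rightarrow> bool" where
  "is_gramian S f T \<longleftrightarrow>
    T \<in> linear_operators S \<and> (\<forall>a\<in>S. \<forall>b\<in>S. matrix_entry S T a b = f b \<bullet> f a)"

end

theory Submission
  imports Defs
begin

text \<open>The Gramian of a Parseval frame is symmetric and idempotent, and left invariant because the
  representation is orthogonal; left invariance of the matrix means membership in the algebra of
  the right translations. A coordinate of the frame vectors is a unit vector in the range, hence odd.

  Conversely, the standard form restricted to the range of \<open>G\<close> is nondegenerate, and the odd
  vector makes it non-alternating, so the range has an orthonormal basis \<open>u\<^sub>0, \<dots>, u\<^sub>n\<^sub>-\<^sub>1\<close>. The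
  vectors \<open>f g = (u\<^sub>i g)\<^sub>i\<close> then form a Parseval frame with Gramian \<open>G\<close>, and the matrices
  \<open>\<rho> g = (\<Sum>h. f (g h) f(h)\<^sup>T)\<close> form the representation.\<close>

text \<open>These rules would turn field operations on \<^typ>\<open>bit\<close> into bit operations, out of reach of
  the ring and sum lemmas.\<close>

declare add_bit_eq_xor [simp del] mult_bit_eq_and [simp del]

section \<open>Symmetric idempotent matrices over a finite index set\<close>

definition fun_dot :: "'s set \<Rightarrow> ('s \<Rightarrow> 'a) \<Rightarrow> ('s \<Rightarrow> 'a) \<Rightarrow> 'a::comm_ring_1" where
  "fun_dot S x y = (\<Sum>a\<in>S. x a * y a)"

definition fun_mult :: "'s set \<Rightarrow> ('s \<Rightarrow> 's \<Rightarrow> 'a) \<Rightarrow> ('s \<Rightarrow> 'a) \<Rightarrow> 's \<Rightarrow> 'a::comm_ring_1" where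
  "fun_mult S M x a = (\<Sum>b\<in>S. M a b * x b)"

definition sym_idem :: "'s set \<Rightarrow> ('s \<Rightarrow> 's \<Rightarrow> 'a::comm_ring_1) \<Rightarrow> bool" where
  "sym_idem S M \<longleftrightarrow> (\<forall>a\<in>S. \<forall>b\<in>S. M a b = M b a) \<and>
     (\<forall>a\<in>S. \<forall>b\<in>S. (\<Sum>c\<in>S. M a c * M c b) = M a b)"

text \<open>For an idempotent \<open>M\<close> this is membership in its range. Equality is asked on
  \<open>S\<close> only, so that arguments need not be extensional.\<close>

definition fixes_fun :: "'s set \<Rightarrow> ('s \<Rightarrow> 's \<Rightarrow> 'a::comm_ring_1) \<Rightarrow> ('s \<Rightarrow> 'a) \<Rightarrow> bool" where
  "fixes_fun S M x \<longleftrightarrow> (\<forall>a\<in>S. fun_mult S M x a = x a)"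

text \<open>For \<open>x\<close> in the range of an orthogonal projection \<open>M\<close> with
  \<open>fun_dot S x x = 1\<close>, this is the projection onto the complement of \<open>x\<close>
  within that range.\<close>

definition deflate :: "('s \<Rightarrow> 's \<Rightarrow> 'a::comm_ring_1) \<Rightarrow> ('s \<Rightarrow> 'a) \<Rightarrow> 's \<Rightarrow> 's \<Rightarrow> 'a" where
  "deflate M x a b = M a b - x a * x b"

lemma fun_dot_commute: "fun_dot S x y = fun_dot S y x"
  by (simp add: fun_dot_def mult.commute)

lemma fun_dot_add:
  "fun_dot S (\<lambda>a. x a + y a) z = fun_dot S x z + fun_dot S y z"
  "fun_dot S z (\<lambda>a. x a + y a) = fun_dot S z x + fun_dot S z y"
  by (simp_all add: fun_dot_def algebra_simps sum.distrib)

lemma fun_dot_cong: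
  assumes "\<And>a. a \<in> S \<Longrightarrow> x a = x' a" "\<And>a. a \<in> S \<Longrightarrow> y a = y' a"
  shows "fun_dot S x y = fun_dot S x' y'"
  unfolding fun_dot_def by (rule sum.cong) (simp_all add: assms)

lemma fun_dot_fun_mult:
  assumes "\<And>a b. a \<in> S \<Longrightarrow> b \<in> S \<Longrightarrow> M a b = M b a"
  shows "fun_dot S x (fun_mult S M y) = fun_dot S (fun_mult S M x) y"
proof -
  have "fun_dot S x (fun_mult S M y) = (\<Sum>a\<in>S. \<Sum>b\<in>S. x a * (M a b * y b))"
    by (simp add: fun_dot_def fun_mult_def sum_distrib_left)
  also have "\<dots> = (\<Sum>b\<in>S. \<Sum>a\<in>S. x a * (M a b * y b))"
    by (rule sum.swap)
  also have "\<dots> = (\<Sum>b\<in>S. \<Sum>a\<in>S. M b a * x a * y b)"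
    by (intro sum.cong) (use assms in \<open>simp_all add: ac_simps\<close>)
  also have "\<dots> = fun_dot S (fun_mult S M x) y"
    by (simp add: fun_dot_def fun_mult_def sum_distrib_right)
  finally show ?thesis .
qed

lemma fixes_fun_add:
  "fixes_fun S M x \<Longrightarrow> fixes_fun S M y \<Longrightarrow> fixes_fun S M (\<lambda>a. x a + y a)"
  by (simp add: fixes_fun_def fun_mult_def algebra_simps sum.distrib)

lemma fixes_fun_restrict: "fixes_fun S M (restrict x S) \<longleftrightarrow> fixes_fun S M x"
  by (simp add: fixes_fun_def fun_mult_def)

lemma fun_dot_restrict: "fun_dot S x (restrict y S) = fun_dot S x y"
  by (simp add: fun_dot_def)

lemma fixes_fun_column:
  assumes "sym_idem S M" "b \<in> S"
  shows "fixes_fun S M (\<lambda>a. M a b)"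
  using assms by (simp add: fixes_fun_def fun_mult_def sym_idem_def)

text \<open>By symmetry column \<open>b\<close> is also row \<open>b\<close>, so the pairing
  computes entry \<open>b\<close> of \<open>M\<close> applied to \<open>y\<close>. The columns act
  as a reproducing kernel on the range.\<close>

lemma fun_dot_column:
  assumes "sym_idem S M" "b \<in> S" "fixes_fun S M y"
  shows "fun_dot S (\<lambda>a. M a b) y = y b"
proof -
  have "fun_dot S (\<lambda>a. M a b) y = fun_mult S M y b"
    unfolding fun_dot_def fun_mult_def
    by (rule sum.cong) (use assms in \<open>simp_all add: sym_idem_def\<close>)
  with assms show ?thesis by (simp add: fixes_fun_def)
qed

lemma fun_mult_deflate: "fun_mult S (deflate M x) v a = fun_mult S M v a - x a * fun_dot S x v"
  by (simp add: fun_mult_def deflate_def fun_dot_def algebra_simps sum_subtractf sum_distrib_left)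

text \<open>The columns of the deflated matrix lie in the range of \<open>M\<close> and are
  orthogonal to \<open>x\<close>, so the deflated matrix fixes them.\<close>

lemma sym_idem_deflate:
  assumes M: "sym_idem S M" and x: "fixes_fun S M x" "fun_dot S x x = 1"
  shows "sym_idem S (deflate M x)"
proof -
  have "(\<Sum>c\<in>S. deflate M x a c * deflate M x c b) = deflate M x a b"
    if ab: "a \<in> S" "b \<in> S" for a b
  proof -
    have dot: "fun_dot S x (\<lambda>c. deflate M x c b) = 0"
    proof -
      have "fun_dot S x (\<lambda>c. deflate M x c b) = fun_dot S (\<lambda>c. M c b) x - x b * fun_dot S x x"
        by (simp add: fun_dot_def deflate_def algebra_simps sum_subtractf sum_distrib_left)
      then show ?thesis using fun_dot_column[OF M ab(2) x(1)] x(2) by simp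
    qed
    have "fun_mult S M (\<lambda>c. deflate M x c b) a = fun_mult S M (\<lambda>c. M c b) a - fun_mult S M x a * x b"
      by (simp add: fun_mult_def deflate_def algebra_simps sum_subtractf sum_distrib_left)
    also have "\<dots> = deflate M x a b"
      using fixes_fun_column[OF M ab(2)] x(1) ab by (simp add: fixes_fun_def deflate_def)
    finally show ?thesis
      using fun_mult_deflate[of S M x "\<lambda>c. deflate M x c b" a] dot by (simp add: fun_mult_def)
  qed
  moreover have "deflate M x a b = deflate M x b a" if "a \<in> S" "b \<in> S" for a b
    using M that by (simp add: deflate_def sym_idem_def mult.commute)
  ultimately show ?thesis by (simp add: sym_idem_def)
qed

text \<open>The deflated matrix kills \<open>x\<close> and is self-adjoint, so whatever it fixes is
  orthogonal to \<open>x\<close>. On vectors orthogonal to \<open>x\<close> it agrees with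
  \<open>M\<close>.\<close>

lemma fixes_fun_deflate_iff:
  assumes M: "sym_idem S M" and x: "fixes_fun S M x" "fun_dot S x x = 1"
  shows "fixes_fun S (deflate M x) v \<longleftrightarrow> fixes_fun S M v \<and> fun_dot S x v = 0"
proof
  assume v: "fixes_fun S (deflate M x) v"
  have "fun_dot S x v = fun_dot S x (fun_mult S (deflate M x) v)"
    using v by (intro fun_dot_cong) (simp_all add: fixes_fun_def)
  also have "\<dots> = fun_dot S (fun_mult S (deflate M x) x) v"
    using sym_idem_deflate[OF assms] by (intro fun_dot_fun_mult) (simp add: sym_idem_def)
  also have "\<dots> = fun_dot S (\<lambda>_. 0) v"
    using x by (intro fun_dot_cong) (simp_all add: fun_mult_deflate fixes_fun_def)
  finally have "fun_dot S x v = 0" by (simp add: fun_dot_def)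
  with v show "fixes_fun S M v \<and> fun_dot S x v = 0"
    by (simp add: fixes_fun_def fun_mult_deflate)
qed (simp add: fixes_fun_def fun_mult_deflate)

section \<open>Orthonormal factorization over the field with two elements\<close>

text \<open>Splitting off an arbitrary odd vector \<open>x\<close> may leave an alternating form. In that case a
  hyperbolic pair \<open>y, z\<close> of the remainder exists, and \<open>x + y\<close> is split off instead: the odd vector
  \<open>x + z\<close> is orthogonal to it.\<close>

lemma odd_vector_deflate:
  fixes M :: "'s \<Rightarrow> 's \<Rightarrow> bit"
  assumes M: "sym_idem S M" and x: "fixes_fun S M x" "fun_dot S x x = 1"
  obtains x' where "fixes_fun S M x'" "fun_dot S x' x' = 1"
    "(\<forall>a\<in>S. \<forall>b\<in>S. deflate M x' a b = 0) \<or>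
     (\<exists>y. fixes_fun S (deflate M x') y \<and> fun_dot S y y = 1)"
proof -
  define D where "D = deflate M x"
  note D = sym_idem_deflate[OF M x, folded D_def]
  note fix_iff = fixes_fun_deflate_iff[OF M x, folded D_def]
  \<comment> \<open>The Gram matrix of the columns of \<open>D\<close> is \<open>D\<close> itself. A
    diagonal entry 1 thus exhibits an odd column; an off-diagonal entry 1 with zero diagonal
    exhibits a hyperbolic pair.\<close>
  have dot: "fun_dot S (\<lambda>c. D c a) (\<lambda>c. D c b) = D a b" if "a \<in> S" "b \<in> S" for a b
    using fun_dot_column[OF D that(1) fixes_fun_column[OF D that(2)]] .
  consider (diag) a where "a \<in> S" "D a a = 1"
    | (zero) "\<forall>a\<in>S. \<forall>b\<in>S. D a b = 0"
    | (alt) a b where "a \<in> S" "b \<in> S" "D a b = 1" "\<forall>a\<in>S. D a a = 0"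
  proof -
    show thesis
    proof (cases "\<exists>a\<in>S. D a a = 1")
      case True
      then show thesis using diag by blast
    next
      case False
      then have "\<forall>a\<in>S. D a a = 0" by simp
      then show thesis using zero alt by (cases "\<exists>a\<in>S. \<exists>b\<in>S. D a b = 1") auto
    qed
  qed
  then show ?thesis
  proof cases
    case diag
    then have "fixes_fun S D (\<lambda>c. D c a)" "fun_dot S (\<lambda>c. D c a) (\<lambda>c. D c a) = 1"
      using fixes_fun_column[OF D] dot by simp_all
    with that[OF x] show ?thesis unfolding D_def by blast
  next
    case zero
    then show ?thesis using that[OF x] unfolding D_def by blast
  next
    case alt
    define y where "y = (\<lambda>c. D c a)"
    define z where "z = (\<lambda>c. D c b)"
    have yz: "fun_dot S y y = 0" "fun_dot S z z = 0" "fun_dot S y z = 1"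
      using dot alt by (simp_all add: y_def z_def)
    have y: "fixes_fun S M y" "fun_dot S x y = 0" and z: "fixes_fun S M z" "fun_dot S x z = 0"
      using fixes_fun_column[OF D] alt fix_iff[of y] fix_iff[of z] by (simp_all add: y_def z_def)
    let ?x' = "\<lambda>c. x c + y c" and ?w = "\<lambda>c. x c + z c"
    have x': "fixes_fun S M ?x'" "fun_dot S ?x' ?x' = 1"
      using fixes_fun_add[OF x(1) y(1)] x(2) y(2) yz
      by (simp_all add: fun_dot_add fun_dot_commute[of S y x])
    have w: "fixes_fun S M ?w" "fun_dot S ?w ?w = 1"
      using fixes_fun_add[OF x(1) z(1)] x(2) z(2) yz
      by (simp_all add: fun_dot_add fun_dot_commute[of S z x])
    \<comment> \<open>The terms \<open>fun_dot S x x\<close> and \<open>fun_dot S y z\<close> are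
      both 1 and cancel in characteristic 2; the mixed terms with \<open>x\<close> vanish.\<close>
    have "fun_dot S ?x' ?w = 0"
      using x(2) y(2) z(2) yz by (simp add: fun_dot_add fun_dot_commute[of S y x])
    with w(1) have "fixes_fun S (deflate M ?x') ?w"
      using fixes_fun_deflate_iff[OF M x'] by blast
    with that[OF x'] w(2) show ?thesis by blast
  qed
qed

text \<open>An odd vector is split off so that the remainder is zero or again has an odd vector in
  its range. Counting the fixed extensional functions gives a finite measure for the induction
  without a notion of dimension.\<close>

lemma orthonormal_factorization:
  fixes M :: "'s \<Rightarrow> 's \<Rightarrow> bit"
  assumes "finite S" and "sym_idem S M" and "fixes_fun S M x" and "fun_dot S x x = 1"
  shows "\<exists>n u. n \<ge> 1 \<and>
    (\<forall>i<n. \<forall>j<n. fun_dot S (u i) (u j) = (if i = j then 1 else 0)) \<and>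
    (\<forall>a\<in>S. \<forall>b\<in>S. M a b = (\<Sum>i<(n::nat). u i a * u i b))"
  using assms(2-)
proof (induction "card {v \<in> S \<rightarrow>\<^sub>E UNIV. fixes_fun S M v}" arbitrary: M x rule: less_induct)
  case less
  note M = less.prems(1)
  obtain x' where x': "fixes_fun S M x'" "fun_dot S x' x' = 1"
    and alt: "(\<forall>a\<in>S. \<forall>b\<in>S. deflate M x' a b = 0) \<or>
     (\<exists>y. fixes_fun S (deflate M x') y \<and> fun_dot S y y = 1)"
    using odd_vector_deflate[OF less.prems] by metis
  note fix_iff = fixes_fun_deflate_iff[OF M x']
  from alt show ?case
  proof
    assume "\<forall>a\<in>S. \<forall>b\<in>S. deflate M x' a b = 0"
    then have "\<forall>a\<in>S. \<forall>b\<in>S. M a b = x' a * x' b"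
      unfolding deflate_def by (metis eq_iff_diff_eq_0)
    with x'(2) show ?thesis
      by (intro exI[of _ 1] exI[of _ "\<lambda>_. x'"]) simp
  next
    assume "\<exists>y. fixes_fun S (deflate M x') y \<and> fun_dot S y y = 1"
    then obtain y where y: "fixes_fun S (deflate M x') y" "fun_dot S y y = 1" by blast
    have "finite (UNIV :: bit set)"
      by (rule finite_subset[of _ "{0, 1}"]) (use bit_not_zero_iff in blast, simp)
    then have fin: "finite {v \<in> S \<rightarrow>\<^sub>E (UNIV :: bit set). fixes_fun S M v}"
      using \<open>finite S\<close> by (simp add: finite_PiE)
    \<comment> \<open>The vector \<open>x'\<close> witnesses the strict decrease: \<open>M\<close>
      fixes it, but the deflated matrix does not, because \<open>x'\<close> is not orthogonal to
      itself.\<close>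
    have "restrict x' S \<in> {v \<in> S \<rightarrow>\<^sub>E UNIV. fixes_fun S M v}"
      using x'(1) by (simp add: fixes_fun_restrict)
    moreover have "restrict x' S \<notin> {v \<in> S \<rightarrow>\<^sub>E UNIV. fixes_fun S (deflate M x') v}"
      using x'(2) by (simp add: fixes_fun_restrict fix_iff fun_dot_restrict)
    ultimately have "{v \<in> S \<rightarrow>\<^sub>E UNIV. fixes_fun S (deflate M x') v} \<subset> {v \<in> S \<rightarrow>\<^sub>E UNIV. fixes_fun S M v}"
      using fix_iff by blast
    from less.hyps[OF psubset_card_mono[OF fin this] sym_idem_deflate[OF M x'] y]
    obtain n u where orth: "\<forall>i<n. \<forall>j<n. fun_dot S (u i) (u j) = (if i = j then 1 else 0)"
      and dec: "\<forall>a\<in>S. \<forall>b\<in>S. deflate M x' a b = (\<Sum>i<(n::nat). u i a * u i b)" by auto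
    \<comment> \<open>By orthonormality the decomposed, deflated matrix fixes each
      \<open>u j\<close>, and everything it fixes is orthogonal to \<open>x'\<close>.\<close>
    have perp: "fun_dot S x' (u j) = 0" if j: "j < n" for j
    proof -
      have "fun_mult S (deflate M x') (u j) a = u j a" if a: "a \<in> S" for a
      proof -
        have "fun_mult S (deflate M x') (u j) a = (\<Sum>b\<in>S. \<Sum>i<n. u i a * u i b * u j b)"
          unfolding fun_mult_def using a dec by (simp add: sum_distrib_right)
        also have "\<dots> = (\<Sum>i<n. \<Sum>b\<in>S. u i a * u i b * u j b)" by (rule sum.swap)
        also have "\<dots> = (\<Sum>i<n. u i a * fun_dot S (u i) (u j))"
          by (simp add: fun_dot_def sum_distrib_left mult.assoc)
        also have "\<dots> = (\<Sum>i<n. if i = j then u i a else 0)"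
          using orth j by (intro sum.cong) auto
        finally show ?thesis using j by simp
      qed
      then show ?thesis using fix_iff[of "u j"] by (simp add: fixes_fun_def)
    qed
    then have perp': "fun_dot S (u j) x' = 0" if "j < n" for j
      using that by (simp add: fun_dot_commute)
    define u' where "u' = (\<lambda>i. case i of 0 \<Rightarrow> x' | Suc k \<Rightarrow> u k)"
    have "fun_dot S (u' i) (u' j) = (if i = j then 1 else 0)" if "i < Suc n" "j < Suc n" for i j
      using that orth perp perp' x'(2)
      by (auto simp: u'_def split: nat.splits)
    moreover have "M a b = (\<Sum>i<Suc n. u' i a * u' i b)" if "a \<in> S" "b \<in> S" for a b
    proof -
      have "M a b = x' a * x' b + deflate M x' a b" by (simp add: deflate_def del: minus_bit_def)
      also have "\<dots> = (\<Sum>i<Suc n. u' i a * u' i b)"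
        using dec that by (simp add: sum.lessThan_Suc_shift u'_def del: sum.lessThan_Suc)
      finally show ?thesis .
    qed
    ultimately show ?thesis by (intro exI[of _ "Suc n"] exI[of _ u']) simp
  qed
qed

section \<open>Operators on functions and their matrices\<close>

lemma std_basis_in: "std_basis S b \<in> bit_functions S"
  by (simp add: std_basis_def)

lemma linear_operator_closed:
  "T \<in> linear_operators S \<Longrightarrow> \<phi> \<in> bit_functions S \<Longrightarrow> T \<phi> \<in> bit_functions S"
  unfolding linear_operators_def by blast

text \<open>Expansion of \<phi> in the standard basis, one basis vector at a time: the induction
  runs over truncations of \<phi> to finite subsets of \<open>S\<close>.\<close>

lemma linear_operator_apply:
  assumes S: "finite S" and T: "T \<in> linear_operators S" and \<phi>: "\<phi> \<in> bit_functions S" and a: "a \<in> S"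
  shows "T \<phi> a = fun_mult S (matrix_entry S T) \<phi> a"
proof -
  have add: "T (\<lambda>h\<in>S. \<phi> h + \<psi> h) = (\<lambda>h\<in>S. T \<phi> h + T \<psi> h)"
    if "\<phi> \<in> bit_functions S" "\<psi> \<in> bit_functions S" for \<phi> \<psi>
    using T that unfolding linear_operators_def by blast
  have scale: "T (\<lambda>h\<in>S. c * \<phi> h) = (\<lambda>h\<in>S. c * T \<phi> h)" if "\<phi> \<in> bit_functions S" for c \<phi>
    using T that unfolding linear_operators_def by blast
  have partial: "T (\<lambda>h\<in>S. if h \<in> F then \<phi> h else 0) a = (\<Sum>b\<in>F. matrix_entry S T a b * \<phi> b)"
    if "finite F" "F \<subseteq> S" for F
    using that
  proof (induction F)
    case empty
    have "T (\<lambda>h\<in>S. 0) = (\<lambda>h\<in>S. 0)" using scale[OF \<phi>, of 0] by simp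
    then have "T (\<lambda>h\<in>S. 0) a = 0" using a by (metis restrict_apply)
    then show ?case by (simp only: empty_iff if_False sum.empty)
  next
    case (insert b F)
    let ?\<psi> = "\<lambda>h\<in>S. if h \<in> F then \<phi> h else 0"
    let ?\<chi> = "\<lambda>h\<in>S. \<phi> b * std_basis S b h"
    have "(\<lambda>h\<in>S. if h \<in> insert b F then \<phi> h else 0) = (\<lambda>h\<in>S. ?\<psi> h + ?\<chi> h)"
      using insert.hyps by (auto simp: std_basis_def fun_eq_iff)
    then have "T (\<lambda>h\<in>S. if h \<in> insert b F then \<phi> h else 0) a = T ?\<psi> a + T ?\<chi> a"
      using add[of ?\<psi> ?\<chi>] a by simp
    also have "T ?\<chi> a = matrix_entry S T a b * \<phi> b"
      using scale[OF std_basis_in, of "\<phi> b" b] a by (simp add: matrix_entry_def mult.commute)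
    finally show ?case using insert by (simp add: add.commute)
  qed
  have "(\<lambda>h\<in>S. if h \<in> S then \<phi> h else 0) = \<phi>"
    using PiE_restrict[OF \<phi>] by (metis (mono_tags, lifting) restrict_ext)
  with partial[OF S subset_refl] show ?thesis by (simp only: fun_mult_def)
qed

lemma idempotent_operator_iff:
  assumes S: "finite S" and T: "T \<in> linear_operators S"
  shows "idempotent_operator S T \<longleftrightarrow> (\<forall>a\<in>S. \<forall>b\<in>S.
    (\<Sum>c\<in>S. matrix_entry S T a c * matrix_entry S T c b) = matrix_entry S T a b)"
    (is "_ \<longleftrightarrow> ?R")
proof
  note app = linear_operator_apply[OF S T]
  note closed = linear_operator_closed[OF T]
  {
    assume "idempotent_operator S T"
    then have idem: "T (T (std_basis S b)) = T (std_basis S b)" for b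
      unfolding idempotent_operator_def by (metis compose_eq std_basis_in)
    show ?R
    proof (intro ballI)
      fix a b assume "a \<in> S" "b \<in> S"
      from app[OF closed[OF std_basis_in] this(1)]
      have "(\<Sum>c\<in>S. matrix_entry S T a c * matrix_entry S T c b) = T (T (std_basis S b)) a"
        by (simp only: fun_mult_def matrix_entry_def)
      then show "(\<Sum>c\<in>S. matrix_entry S T a c * matrix_entry S T c b) = matrix_entry S T a b"
        by (simp only: idem) (simp only: matrix_entry_def)
    qed
  }
  assume R: ?R
  have "T (T \<phi>) a = T \<phi> a" if \<phi>: "\<phi> \<in> bit_functions S" and a: "a \<in> S" for \<phi> a
  proof -
    let ?M = "matrix_entry S T"
    have "T (T \<phi>) a = (\<Sum>c\<in>S. \<Sum>b\<in>S. ?M a c * ?M c b * \<phi> b)"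
      using app[OF closed[OF \<phi>] a] app[OF \<phi>]
      by (simp add: fun_mult_def sum_distrib_left mult.assoc)
    also have "\<dots> = (\<Sum>b\<in>S. \<Sum>c\<in>S. ?M a c * ?M c b * \<phi> b)" by (rule sum.swap)
    also have "\<dots> = (\<Sum>b\<in>S. ?M a b * \<phi> b)" using R a by (simp flip: sum_distrib_right)
    also have "\<dots> = T \<phi> a" using app[OF \<phi> a] by (simp add: fun_mult_def)
    finally show ?thesis .
  qed
  then have "T (T \<phi>) = T \<phi>" if "\<phi> \<in> bit_functions S" for \<phi>
    using that closed by (intro PiE_ext[where k = S and s = "\<lambda>_. UNIV"]) auto
  \<comment> \<open>Since \<open>compose\<close> is \<open>undefined\<close> off the function space,
    equality of operators also requires this of \<open>T\<close>.\<close>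
  moreover have "T \<in> extensional (bit_functions S)"
    using T unfolding linear_operators_def by (auto simp: PiE_def)
  ultimately show "idempotent_operator S T"
    unfolding idempotent_operator_def
    by (auto simp: fun_eq_iff compose_def extensional_def)
qed

lemma sym_idem_matrix_entry_iff:
  assumes "finite S" "T \<in> linear_operators S"
  shows "sym_idem S (matrix_entry S T) \<longleftrightarrow> symmetric_operator S T \<and> idempotent_operator S T"
  by (simp add: sym_idem_def symmetric_operator_def idempotent_operator_iff[OF assms])

lemma range_idempotent_operator:
  assumes S: "finite S" and T: "T \<in> linear_operators S" and "idempotent_operator S T"
  shows "T ` bit_functions S = {\<phi> \<in> bit_functions S. fixes_fun S (matrix_entry S T) \<phi>}"
proof (intro equalityI subsetI)
  fix \<psi> assume "\<psi> \<in> T ` bit_functions S"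
  then obtain \<phi> where \<phi>: "\<phi> \<in> bit_functions S" "\<psi> = T \<phi>" by blast
  then have "T \<psi> = \<psi>"
    using assms(3) unfolding idempotent_operator_def by (metis compose_eq)
  moreover have \<psi>: "\<psi> \<in> bit_functions S" using \<phi> linear_operator_closed[OF T] by blast
  ultimately have "fun_mult S (matrix_entry S T) \<psi> a = \<psi> a" if "a \<in> S" for a
    using linear_operator_apply[OF S T \<psi> that] by metis
  with \<psi> show "\<psi> \<in> {\<phi> \<in> bit_functions S. fixes_fun S (matrix_entry S T) \<phi>}"
    by (simp add: fixes_fun_def)
next
  fix \<phi> assume \<phi>: "\<phi> \<in> {\<phi> \<in> bit_functions S. fixes_fun S (matrix_entry S T) \<phi>}"
  then have "T \<phi> = \<phi>"
    using linear_operator_apply[OF S T] linear_operator_closed[OF T, of \<phi>]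
    by (intro PiE_ext[where k = S and s = "\<lambda>_. UNIV"]) (auto simp: fixes_fun_def)
  with \<phi> show "\<phi> \<in> T ` bit_functions S" by force
qed

text \<open>Every element of \<open>bit\<close> is its own square, so the dot product counts the
  ones modulo 2. This makes odd vectors the ones that can be split off orthogonally.\<close>

lemma odd_vector_iff:
  assumes "finite S"
  shows "odd_vector S \<phi> \<longleftrightarrow> fun_dot S \<phi> \<phi> = 1"
proof -
  have "fun_dot S \<phi> \<phi> = of_nat (card {h \<in> S. \<phi> h = 1})"
  proof -
    have "\<phi> h * \<phi> h = (if \<phi> h = 1 then 1 else 0)" for h by (cases "\<phi> h") simp_all
    then show ?thesis using assms by (simp add: fun_dot_def flip: sum.inter_filter)
  qed
  moreover have "(of_nat k :: bit) = 1 \<longleftrightarrow> odd k" for k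
    by (metis bit_not_zero_iff even_of_nat even_zero odd_one)
  ultimately show ?thesis by (simp add: odd_vector_def)
qed

text \<open>Right translation by \<open>g\<close> has entry 1 at \<open>(a, b)\<close> exactly when
  \<open>b = a \<otimes> g\<close>. A combination with coefficients \<open>c\<close> therefore has
  entries \<open>c (inv a \<otimes> b)\<close>, and \<open>inv a \<otimes> b\<close> is unchanged by
  left translation.\<close>

lemma right_regular_algebra_iff:
  fixes \<Gamma> (structure)
  assumes "group \<Gamma>" and fin: "finite (carrier \<Gamma>)" and T: "T \<in> linear_operators (carrier \<Gamma>)"
  shows "T \<in> right_regular_algebra \<Gamma> \<longleftrightarrow>
    (\<forall>g\<in>carrier \<Gamma>. \<forall>a\<in>carrier \<Gamma>. \<forall>b\<in>carrier \<Gamma>.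
      matrix_entry (carrier \<Gamma>) T (g \<otimes>\<^bsub>\<Gamma>\<^esub> a) (g \<otimes>\<^bsub>\<Gamma>\<^esub> b) = matrix_entry (carrier \<Gamma>) T a b)"
    (is "_ \<longleftrightarrow> ?R")
proof -
  interpret group \<Gamma> by fact
  let ?S = "carrier \<Gamma>"
  let ?M = "matrix_entry ?S T"
  show ?thesis
  proof
    assume "T \<in> right_regular_algebra \<Gamma>"
    then obtain c where c: "T = (\<lambda>\<phi>\<in>bit_functions ?S. \<lambda>h\<in>?S. \<Sum>g\<in>?S. c g * right_regular \<Gamma> g \<phi> h)"
      unfolding right_regular_algebra_def by blast
    have "?M a b = c (inv a \<otimes> b)" if ab: "a \<in> ?S" "b \<in> ?S" for a b
    proof -
      have "?M a b = (\<Sum>g\<in>?S. c g * std_basis ?S b (a \<otimes> g))"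
        using ab std_basis_in[of ?S b] by (simp add: matrix_entry_def c right_regular_def)
      also have "\<dots> = (\<Sum>g\<in>?S. if g = inv a \<otimes> b then c g else 0)"
        using ab inv_solve_left[of _ a b] by (intro sum.cong) (auto simp: std_basis_def)
      also have "\<dots> = c (inv a \<otimes> b)" using ab fin by simp
      finally show ?thesis .
    qed
    moreover have "inv (g \<otimes> a) \<otimes> (g \<otimes> b) = inv a \<otimes> b"
      if "g \<in> ?S" "a \<in> ?S" "b \<in> ?S" for g a b
    proof -
      have "inv g \<otimes> (g \<otimes> b) = b" using that by (simp flip: m_assoc)
      then show ?thesis using that by (simp add: inv_mult_group m_assoc)
    qed
    ultimately show ?R by simp
  next
    assume R: ?R
    \<comment> \<open>The entry formula forces the coefficients to be the identity row of the
      matrix. Invariance under left translation by \<open>a\<close> carries that row to row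
      \<open>a\<close>.\<close>
    have "T \<phi> a = (\<Sum>g\<in>?S. ?M \<one> g * right_regular \<Gamma> g \<phi> a)"
      if \<phi>: "\<phi> \<in> bit_functions ?S" and a: "a \<in> ?S" for \<phi> a
    proof -
      have "T \<phi> a = (\<Sum>b\<in>?S. ?M a b * \<phi> b)"
        using linear_operator_apply[OF fin T \<phi> a] by (simp add: fun_mult_def)
      also have "\<dots> = (\<Sum>g\<in>?S. ?M a (a \<otimes> g) * \<phi> (a \<otimes> g))"
        using a by (intro sum.reindex_bij_witness[of _ "\<lambda>g. a \<otimes> g" "\<lambda>b. inv a \<otimes> b"])
          (auto simp flip: m_assoc)
      also have "\<dots> = (\<Sum>g\<in>?S. ?M \<one> g * right_regular \<Gamma> g \<phi> a)"
        using R[rule_format, of a \<one>] a \<phi> by (intro sum.cong) (auto simp: right_regular_def)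
      finally show ?thesis .
    qed
    moreover have "T \<in> extensional (bit_functions ?S)"
      using T unfolding linear_operators_def by (auto simp: PiE_def)
    moreover have "T \<phi> h = undefined" if "\<phi> \<in> bit_functions ?S" "h \<notin> ?S" for \<phi> h
      using linear_operator_closed[OF T that(1)] that(2) by (rule PiE_arb)
    ultimately have "T = (\<lambda>\<phi>\<in>bit_functions ?S. \<lambda>h\<in>?S. \<Sum>g\<in>?S. ?M \<one> g * right_regular \<Gamma> g \<phi> h)"
      by (intro ext) (auto simp: restrict_def extensional_def fun_eq_iff)
    then show "T \<in> right_regular_algebra \<Gamma>" unfolding right_regular_algebra_def by blast
  qed
qed

section \<open>Binary Parseval frames\<close>

lemma finsum_vec_smult_index:
  fixes f :: "'j \<Rightarrow> 'a::comm_ring_1 vec"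
  assumes "finite J" "\<And>j. j \<in> J \<Longrightarrow> f j \<in> carrier_vec n" "k < n"
  shows "finsum_vec TYPE('a) n (\<lambda>j. c j \<cdot>\<^sub>v f j) J $ k = (\<Sum>j\<in>J. c j * f j $ k)"
proof -
  have "(c j \<cdot>\<^sub>v f j) $ k = c j * f j $ k" if "j \<in> J" for j
    using assms(2)[OF that] assms(3) by simp
  then show ?thesis
    using index_finsum_vec[OF assms(1,3), of "\<lambda>j. c j \<cdot>\<^sub>v f j"] assms(2) by simp
qed

text \<open>Reconstruction says that the frame operator is the identity matrix, which can be tested
  on unit vectors. Equivalently the coordinate functions \<open>\<lambda>j. f j $ i\<close> are
  orthonormal, the form in which the factorization delivers them.\<close>

lemma parseval_frame_iff:
  assumes J: "finite J" and f: "\<And>j. j \<in> J \<Longrightarrow> f j \<in> carrier_vec n"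
  shows "parseval_frame n J f \<longleftrightarrow>
    (\<forall>i<n. \<forall>k<n. (\<Sum>j\<in>J. f j $ i * f j $ k) = (if i = k then 1 else 0))" (is "_ \<longleftrightarrow> ?R")
proof
  have index: "finsum_vec TYPE(bit) n (\<lambda>j. (x \<bullet> f j) \<cdot>\<^sub>v f j) J $ k = (\<Sum>j\<in>J. (x \<bullet> f j) * f j $ k)"
    if "k < n" for x k
    by (rule finsum_vec_smult_index[OF J f that])
  {
    assume P: "parseval_frame n J f"
    show ?R
    proof (intro allI impI)
      fix i k assume ik: "i < n" "k < n"
      have "unit_vec n i $ k = (\<Sum>j\<in>J. (unit_vec n i \<bullet> f j) * f j $ k)"
        using P index[OF ik(2)] unfolding parseval_frame_def by (metis unit_vec_carrier)
      then show "(\<Sum>j\<in>J. f j $ i * f j $ k) = (if i = k then 1 else 0)"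
        using f ik by (simp add: scalar_prod_left_unit eq_commute)
    qed
  }
  assume R: ?R
  have "x = finsum_vec TYPE(bit) n (\<lambda>j. (x \<bullet> f j) \<cdot>\<^sub>v f j) J" if x: "x \<in> carrier_vec n" for x
  proof (rule eq_vecI)
    have "finsum_vec TYPE(bit) n (\<lambda>j. (x \<bullet> f j) \<cdot>\<^sub>v f j) J \<in> carrier_vec n"
      using f by (intro finsum_vec_closed) auto
    then show dim: "dim_vec x = dim_vec (finsum_vec TYPE(bit) n (\<lambda>j. (x \<bullet> f j) \<cdot>\<^sub>v f j) J)"
      using x by simp
    fix k assume "k < dim_vec (finsum_vec TYPE(bit) n (\<lambda>j. (x \<bullet> f j) \<cdot>\<^sub>v f j) J)"
    then have k: "k < n" using dim x by simp
    have "(\<Sum>j\<in>J. (x \<bullet> f j) * f j $ k) = (\<Sum>j\<in>J. \<Sum>i<n. x $ i * (f j $ i * f j $ k))"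
      using f[THEN carrier_vecD] by (intro sum.cong)
        (auto simp: scalar_prod_def sum_distrib_right mult.assoc atLeast0LessThan)
    also have "\<dots> = (\<Sum>i<n. x $ i * (\<Sum>j\<in>J. f j $ i * f j $ k))"
      by (subst sum.swap) (simp add: sum_distrib_left)
    also have "\<dots> = (\<Sum>i<n. if i = k then x $ i else 0)"
      using R k by (intro sum.cong) auto
    also have "\<dots> = x $ k" using k by simp
    finally show "x $ k = finsum_vec TYPE(bit) n (\<lambda>j. (x \<bullet> f j) \<cdot>\<^sub>v f j) J $ k"
      using index[OF k] by simp
  qed
  then show "parseval_frame n J f" using J f by (simp add: parseval_frame_def)
qed

text \<open>The reconstruction of \<open>x\<close> is paired with \<open>y\<close>. For frame
  vectors this is idempotence of the Gramian; for a unit vector \<open>x\<close> and frame vectors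
  \<open>y\<close> it says that the Gramian fixes a coordinate function.\<close>

lemma parseval_frame_dot:
  assumes P: "parseval_frame n J f" and x: "x \<in> carrier_vec n" and y: "y \<in> carrier_vec n"
  shows "x \<bullet> y = (\<Sum>j\<in>J. (x \<bullet> f j) * (f j \<bullet> y))"
proof -
  have J: "finite J" and f: "\<And>j. j \<in> J \<Longrightarrow> f j \<in> carrier_vec n"
    and x_eq: "x = finsum_vec TYPE(bit) n (\<lambda>j. (x \<bullet> f j) \<cdot>\<^sub>v f j) J"
    using P x by (auto simp: parseval_frame_def)
  have index: "x $ k = (\<Sum>j\<in>J. (x \<bullet> f j) * f j $ k)" if "k < n" for k
  proof -
    have "x $ k = finsum_vec TYPE(bit) n (\<lambda>j. (x \<bullet> f j) \<cdot>\<^sub>v f j) J $ k" using x_eq by simp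
    then show ?thesis
      using finsum_vec_smult_index[OF J f that, where c = "\<lambda>j. x \<bullet> f j"] by simp
  qed
  have "x \<bullet> y = (\<Sum>k<n. \<Sum>j\<in>J. (x \<bullet> f j) * (f j $ k * y $ k))"
    using y index by (simp add: scalar_prod_def[of x] atLeast0LessThan sum_distrib_right mult.assoc)
  also have "\<dots> = (\<Sum>j\<in>J. (x \<bullet> f j) * (f j \<bullet> y))"
    using y by (subst sum.swap)
      (simp add: scalar_prod_def[of _ y] atLeast0LessThan sum_distrib_left)
  finally show ?thesis .
qed

lemma parseval_frame_mult_dot:
  assumes P: "parseval_frame n J f" and A: "A \<in> carrier_mat n n"
    and x: "x \<in> carrier_vec n" and y: "y \<in> carrier_vec n"
  shows "(A *\<^sub>v x) \<bullet> y = (\<Sum>j\<in>J. (x \<bullet> f j) * ((A *\<^sub>v f j) \<bullet> y))"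
proof -
  have adj: "(A *\<^sub>v z) \<bullet> y = z \<bullet> (transpose_mat A *\<^sub>v y)" if z: "z \<in> carrier_vec n" for z
  proof -
    have "(A *\<^sub>v z) \<bullet> y = y \<bullet> (A *\<^sub>v z)"
      using A y z by (intro comm_scalar_prod[where n = n]) auto
    also have "\<dots> = (transpose_mat A *\<^sub>v y) \<bullet> z"
      using transpose_vec_mult_scalar[OF A z y] by simp
    also have "\<dots> = z \<bullet> (transpose_mat A *\<^sub>v y)"
      using A y z by (intro comm_scalar_prod[where n = n]) auto
    finally show ?thesis .
  qed
  have "f j \<in> carrier_vec n" if "j \<in> J" for j
    using P that by (simp add: parseval_frame_def)
  moreover have "transpose_mat A *\<^sub>v y \<in> carrier_vec n" using A y by simp
  ultimately show ?thesis
    using parseval_frame_dot[OF P x, of "transpose_mat A *\<^sub>v y"] adj x by simp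
qed

section \<open>Group frames: invariance of dot products and the representation\<close>

text \<open>With \<open>A\<close> the Gramian and \<open>H\<close> the Gramian of the translated family, reconstruction through
  \<open>\<rho> g\<close> and \<open>\<rho> (inv g)\<close> gives \<open>A H = H\<close> and \<open>H A = A\<close>; transposing the latter yields \<open>A = H\<close>.\<close>

lemma parseval_group_frame_imp_invariant:
  fixes \<Gamma> (structure)
  assumes "group \<Gamma>" and F: "parseval_group_frame n \<Gamma> f"
    and g: "g \<in> carrier \<Gamma>" and a: "a \<in> carrier \<Gamma>" and b: "b \<in> carrier \<Gamma>"
  shows "f (g \<otimes>\<^bsub>\<Gamma>\<^esub> a) \<bullet> f (g \<otimes>\<^bsub>\<Gamma>\<^esub> b) = f a \<bullet> f b"
proof -
  interpret group \<Gamma> by fact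
  let ?S = "carrier \<Gamma>"
  from F obtain \<rho> where P: "parseval_frame n ?S f" and \<rho>: "\<rho> \<in> hom \<Gamma> (GL_bit n)"
    and f\<rho>: "\<And>g. g \<in> ?S \<Longrightarrow> f g = \<rho> g *\<^sub>v f \<one>"
    unfolding parseval_group_frame_def by blast
  have f: "f h \<in> carrier_vec n" if "h \<in> ?S" for h
    using P that by (simp add: parseval_frame_def)
  have \<rho>_mat: "\<rho> h \<in> carrier_mat n n" if "h \<in> ?S" for h
    using \<rho> that by (auto simp: hom_def GL_bit_def units_of_def Units_def ring_mat_def)
  have \<rho>_apply: "\<rho> h *\<^sub>v f k = f (h \<otimes> k)" if "h \<in> ?S" "k \<in> ?S" for h k
  proof -
    have "\<rho> (h \<otimes> k) = \<rho> h * \<rho> k"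
      using hom_mult[OF \<rho> that] by (simp add: GL_bit_def units_of_def ring_mat_def)
    then show ?thesis
      using that f\<rho>[of k] f\<rho>[of "h \<otimes> k"] \<rho>_mat f[OF one_closed]
      by (simp add: assoc_mult_mat_vec[of _ n n _ n])
  qed
  define A where "A = (\<lambda>a b. f a \<bullet> f b)"
  define H where "H = (\<lambda>a b. f (g \<otimes> a) \<bullet> f (g \<otimes> b))"
  have sym: "A a b = A b a" "H a b = H b a" if "a \<in> ?S" "b \<in> ?S" for a b
    using that g f unfolding A_def H_def by (auto intro: comm_scalar_prod[where n = n])
  have AH: "H a b = (\<Sum>c\<in>?S. A a c * H c b)" if "a \<in> ?S" "b \<in> ?S" for a b
    using parseval_frame_mult_dot[OF P \<rho>_mat[OF g] f f, of a "g \<otimes> b"] that g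
    by (simp add: \<rho>_apply A_def H_def)
  have HA: "A a b = (\<Sum>c\<in>?S. H a c * A c b)" if ab: "a \<in> ?S" "b \<in> ?S" for a b
  proof -
    \<comment> \<open>The matrix of \<open>inv g\<close> sends \<open>f (g \<otimes> a)\<close> back
      to \<open>f a\<close>, so the expansion applies to the translated vector; replacing
      \<open>c\<close> by \<open>g \<otimes> c\<close> then produces the entries of
      \<open>H\<close>.\<close>
    have "A a b = (\<rho> (inv g) *\<^sub>v f (g \<otimes> a)) \<bullet> f b"
      using ab g by (simp add: \<rho>_apply A_def flip: m_assoc)
    also have "\<dots> = (\<Sum>c\<in>?S. (f (g \<otimes> a) \<bullet> f c) * (f (inv g \<otimes> c) \<bullet> f b))"
      using parseval_frame_mult_dot[OF P \<rho>_mat f f, of "inv g" "g \<otimes> a" b] ab g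
      by (simp add: \<rho>_apply)
    also have "\<dots> = (\<Sum>c\<in>?S. H a c * A c b)"
      unfolding A_def H_def using g
      by (intro sum.reindex_bij_witness[of _ "\<lambda>c. g \<otimes> c" "\<lambda>c. inv g \<otimes> c"]) (auto simp flip: m_assoc)
    finally show ?thesis .
  qed
  have "A a b = (\<Sum>c\<in>?S. H b c * A c a)" using sym(1)[OF a b] HA[OF b a] by simp
  also have "\<dots> = (\<Sum>c\<in>?S. A a c * H c b)"
    using sym a b by (intro sum.cong) (simp_all add: mult.commute)
  finally show ?thesis using AH[OF a b] by (simp add: A_def H_def)
qed

text \<open>Equality of dot products turns the sum of \<open>f (g \<otimes> h)\<close> weighted by
  \<open>f h \<bullet> f b\<close> into the reconstruction of
  \<open>f (g \<otimes> b)\<close>.\<close>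

lemma parseval_group_frameI:
  fixes \<Gamma> (structure)
  assumes "group \<Gamma>" and P: "parseval_frame n (carrier \<Gamma>) f"
    and inv: "\<And>g a b. g \<in> carrier \<Gamma> \<Longrightarrow> a \<in> carrier \<Gamma> \<Longrightarrow> b \<in> carrier \<Gamma> \<Longrightarrow>
      f (g \<otimes>\<^bsub>\<Gamma>\<^esub> a) \<bullet> f (g \<otimes>\<^bsub>\<Gamma>\<^esub> b) = f a \<bullet> f b"
  shows "parseval_group_frame n \<Gamma> f"
proof -
  interpret group \<Gamma> by fact
  let ?S = "carrier \<Gamma>"
  have fin: "finite ?S" and f: "\<And>h. h \<in> ?S \<Longrightarrow> f h \<in> carrier_vec n"
    using P by (auto simp: parseval_frame_def)
  have f_dim: "dim_vec (f h) = n" if "h \<in> ?S" for h using f[OF that] by simp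
  \<comment> \<open>This matrix sends \<open>x\<close> to the sum of
    \<open>f (g \<otimes> h)\<close> weighted by \<open>x \<bullet> f h\<close>. A linear map taking
    each \<open>f h\<close> to \<open>f (g \<otimes> h)\<close> must have this form, as applying it
    to the reconstruction of \<open>x\<close> shows.\<close>
  define \<rho> where "\<rho> = (\<lambda>g. mat n n (\<lambda>(i, j). \<Sum>h\<in>?S. f (g \<otimes> h) $ i * f h $ j))"
  have \<rho>_mat: "\<rho> g \<in> carrier_mat n n" for g by (simp add: \<rho>_def)
  have \<rho>_apply: "\<rho> g *\<^sub>v f b = f (g \<otimes> b)" if gb: "g \<in> ?S" "b \<in> ?S" for g b
  proof (rule eq_vecI)
    show "dim_vec (\<rho> g *\<^sub>v f b) = dim_vec (f (g \<otimes> b))" using gb f_dim by (simp add: \<rho>_def)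
    fix i assume "i < dim_vec (f (g \<otimes> b))"
    then have i: "i < n" using gb f_dim by simp
    have "(\<rho> g *\<^sub>v f b) $ i = (\<Sum>j<n. \<Sum>h\<in>?S. f (g \<otimes> h) $ i * (f h $ j * f b $ j))"
      using i gb f_dim
      by (simp add: \<rho>_def scalar_prod_def atLeast0LessThan sum_distrib_right mult.assoc)
    also have "\<dots> = (\<Sum>h\<in>?S. f (g \<otimes> h) $ i * (f h \<bullet> f b))"
      using gb f_dim
      by (subst sum.swap) (simp add: scalar_prod_def atLeast0LessThan sum_distrib_left)
    also have "\<dots> = (\<Sum>h\<in>?S. f (g \<otimes> h) $ i * (f (g \<otimes> h) \<bullet> f (g \<otimes> b)))"
      using gb by (simp add: inv)
    also have "\<dots> = (\<Sum>h\<in>?S. f h $ i * (f h \<bullet> f (g \<otimes> b)))"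
      using gb by (intro sum.reindex_bij_witness[of _ "\<lambda>c. inv g \<otimes> c" "\<lambda>c. g \<otimes> c"])
        (auto simp flip: m_assoc)
    also have "\<dots> = unit_vec n i \<bullet> f (g \<otimes> b)"
      using parseval_frame_dot[OF P unit_vec_carrier f, of "g \<otimes> b" i] gb f i
      by (simp add: scalar_prod_left_unit)
    also have "\<dots> = f (g \<otimes> b) $ i" using gb f i by (simp add: scalar_prod_left_unit)
    finally show "(\<rho> g *\<^sub>v f b) $ i = f (g \<otimes> b) $ i" .
  qed
  \<comment> \<open>Multiplying by the matrix of \<open>g\<close> translates each
    \<open>f (k \<otimes> h)\<close> in the sum defining the matrix of \<open>k\<close>, which gives
    the sum for \<open>g \<otimes> k\<close>.\<close>
  have \<rho>_mult: "\<rho> (g \<otimes> k) = \<rho> g * \<rho> k" if gk: "g \<in> ?S" "k \<in> ?S" for g k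
  proof (rule eq_matI)
    fix i j assume "i < dim_row (\<rho> g * \<rho> k)" "j < dim_col (\<rho> g * \<rho> k)"
    then have ij: "i < n" "j < n" by (simp_all add: \<rho>_def)
    have "(\<rho> g * \<rho> k) $$ (i, j) = (\<Sum>l<n. \<rho> g $$ (i, l) * (\<Sum>h\<in>?S. f (k \<otimes> h) $ l * f h $ j))"
      using ij by (simp add: scalar_prod_def \<rho>_def atLeast0LessThan)
    also have "\<dots> = (\<Sum>l<n. \<Sum>h\<in>?S. \<rho> g $$ (i, l) * f (k \<otimes> h) $ l * f h $ j)"
      by (simp add: sum_distrib_left mult.assoc)
    also have "\<dots> = (\<Sum>h\<in>?S. (\<rho> g *\<^sub>v f (k \<otimes> h)) $ i * f h $ j)"
      using ij gk f_dim \<rho>_mat[of g]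
      by (subst sum.swap) (simp add: scalar_prod_def atLeast0LessThan sum_distrib_right)
    also have "\<dots> = \<rho> (g \<otimes> k) $$ (i, j)"
      using ij gk by (simp add: \<rho>_apply m_assoc) (simp add: \<rho>_def m_assoc)
    finally show "\<rho> (g \<otimes> k) $$ (i, j) = (\<rho> g * \<rho> k) $$ (i, j)" by simp
  qed (simp_all add: \<rho>_def)
  \<comment> \<open>At the identity the defining sum is the frame operator.\<close>
  have \<rho>_one: "\<rho> \<one> = 1\<^sub>m n"
  proof (rule eq_matI)
    fix i j assume "i < dim_row (1\<^sub>m n :: bit mat)" "j < dim_col (1\<^sub>m n :: bit mat)"
    then show "\<rho> \<one> $$ (i, j) = 1\<^sub>m n $$ (i, j)"
      using P by (simp add: \<rho>_def parseval_frame_iff[OF fin f])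
  qed (simp_all add: \<rho>_def)
  have "\<rho> g \<in> Units (ring_mat TYPE(bit) n ())" if "g \<in> ?S" for g
    using \<rho>_mult[of g "inv g"] \<rho>_mult[of "inv g" g] \<rho>_mat that \<rho>_one
    by (auto simp: Units_def ring_mat_def intro!: bexI[of _ "\<rho> (inv g)"])
  then have "\<rho> \<in> hom \<Gamma> (GL_bit n)"
    using \<rho>_mult by (auto simp: hom_def GL_bit_def units_of_def ring_mat_def)
  moreover have "f g = \<rho> g *\<^sub>v f \<one>" if "g \<in> ?S" for g
    using \<rho>_apply[OF that one_closed] that by simp
  ultimately show ?thesis using P unfolding parseval_group_frame_def by blast
qed

section \<open>Characterization of Gramians of binary Parseval group frames\<close>

theorem theorem3p4:
  fixes \<Gamma> :: "('g, 'm) monoid_scheme"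
    and G :: "('g \<Rightarrow> bit) \<Rightarrow> ('g \<Rightarrow> bit)"
  assumes "group \<Gamma>" and "finite (carrier \<Gamma>)"
    and "G \<in> linear_operators (carrier \<Gamma>)"
  shows "(\<exists>n f. n \<ge> 1 \<and> parseval_group_frame n \<Gamma> f \<and> is_gramian (carrier \<Gamma>) f G) \<longleftrightarrow>
    symmetric_operator (carrier \<Gamma>) G \<and>
    idempotent_operator (carrier \<Gamma>) G \<and>
    G \<in> right_regular_algebra \<Gamma> \<and>
    (\<exists>\<phi> \<in> G ` bit_functions (carrier \<Gamma>). odd_vector (carrier \<Gamma>) \<phi>)"
    (is "?L \<longleftrightarrow> ?R")
proof
  interpret group \<Gamma> by fact
  let ?S = "carrier \<Gamma>"
  let ?M = "matrix_entry ?S G"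
  note algebra_iff = right_regular_algebra_iff[OF assms]
  note sym_idem_iff = sym_idem_matrix_entry_iff[OF assms(2,3)]
  note range = range_idempotent_operator[OF assms(2,3)]
  {
    assume ?L
    then obtain n f where n: "n \<ge> 1" and F: "parseval_group_frame n \<Gamma> f"
      and M: "\<And>a b. a \<in> ?S \<Longrightarrow> b \<in> ?S \<Longrightarrow> ?M a b = f b \<bullet> f a"
      unfolding is_gramian_def by blast
    have P: "parseval_frame n ?S f" using F by (simp add: parseval_group_frame_def)
    have f: "\<And>h. h \<in> ?S \<Longrightarrow> f h \<in> carrier_vec n" using P by (simp add: parseval_frame_def)
    have dot_comm: "f a \<bullet> f b = f b \<bullet> f a" if "a \<in> ?S" "b \<in> ?S" for a b
      using f that by (intro comm_scalar_prod[where n = n]) auto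
    have "(\<Sum>c\<in>?S. ?M a c * ?M c b) = ?M a b" if "a \<in> ?S" "b \<in> ?S" for a b
      using parseval_frame_dot[OF P f f, of b a] that by (simp add: M mult.commute)
    then have si: "sym_idem ?S ?M" by (simp add: sym_idem_def M dot_comm)
    have "G \<in> right_regular_algebra \<Gamma>"
      using parseval_group_frame_imp_invariant[OF assms(1) F] by (simp add: algebra_iff M)
    moreover have "\<exists>\<phi>\<in>G ` bit_functions ?S. odd_vector ?S \<phi>"
    proof -
      \<comment> \<open>Coordinate 0 exists because \<open>n \<ge> 1\<close>. The Gramian fixes this
        coordinate function, and the Parseval condition at \<open>i = k = 0\<close> makes it
        odd.\<close>
      define \<phi> where "\<phi> = (\<lambda>h\<in>?S. f h $ 0)"
      have "(\<Sum>b\<in>?S. ?M a b * \<phi> b) = \<phi> a" if a: "a \<in> ?S" for a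
        using parseval_frame_dot[OF P unit_vec_carrier f[OF a], of 0] n f a
        by (simp add: M \<phi>_def scalar_prod_left_unit mult.commute)
      then have "\<phi> \<in> G ` bit_functions ?S"
        using si by (simp add: range sym_idem_iff fixes_fun_def fun_mult_def \<phi>_def)
      moreover have "fun_dot ?S \<phi> \<phi> = 1"
        using P n f by (simp add: parseval_frame_iff assms(2) fun_dot_def \<phi>_def)
      ultimately show ?thesis using odd_vector_iff[OF assms(2)] by blast
    qed
    ultimately show ?R using si by (simp add: sym_idem_iff)
  }
  assume R: ?R
  then have si: "sym_idem ?S ?M" by (simp add: sym_idem_iff)
  from R obtain x where x: "fixes_fun ?S ?M x" "fun_dot ?S x x = 1"
    using range odd_vector_iff[OF assms(2)] by auto
  from orthonormal_factorization[OF assms(2) si x] obtain n :: nat and u where n: "n \<ge> 1"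
    and orth: "\<forall>i<n. \<forall>j<n. fun_dot ?S (u i) (u j) = (if i = j then 1 else 0)"
    and dec: "\<forall>a\<in>?S. \<forall>b\<in>?S. ?M a b = (\<Sum>i<n. u i a * u i b)"
    by blast
  \<comment> \<open>The family is read transposed: \<open>u i\<close> becomes coordinate function
    \<open>i\<close>. Its orthonormality is then the Parseval condition, and the factorization is
    the Gramian identity.\<close>
  define f where "f = (\<lambda>h. vec n (\<lambda>i. u i h))"
  have dot: "f b \<bullet> f a = ?M a b" if "a \<in> ?S" "b \<in> ?S" for a b
    using dec that by (simp add: f_def scalar_prod_def atLeast0LessThan mult.commute)
  have "parseval_frame n ?S f"
    using orth by (subst parseval_frame_iff[OF assms(2)]) (simp_all add: f_def fun_dot_def)
  moreover have "f (g \<otimes>\<^bsub>\<Gamma>\<^esub> a) \<bullet> f (g \<otimes>\<^bsub>\<Gamma>\<^esub> b) = f a \<bullet> f b" if "g \<in> ?S" "a \<in> ?S" "b \<in> ?S" for g a b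
    using R that by (simp add: dot algebra_iff)
  ultimately have "parseval_group_frame n \<Gamma> f" by (rule parseval_group_frameI[OF assms(1)])
  moreover have "is_gramian ?S f G" using assms(3) dot by (simp add: is_gramian_def)
  ultimately show ?L using n by blast
qed

end
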